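(* Let $(\mathfrak{g},\mu,N)$ be a Nijenhuis Leibniz algebra and let $(\mu_t,N_t)$ and $(\mu'_t,N'_t)$ be two equivalent formal one-parameter deformations of it. Then their infinitesimals $(\mu_1,N_1)$ and $(\mu'_1,N'_1)$ are in the same cohomology class in $H^2_{NLA}(\mathfrak{g},\mathfrak{g})$; i.e. $(\mu'_1,N'_1)-(\mu_1,N_1)$ lies in the image of $d^1:C^1_{NLA}(\mathfrak{g},\mathfrak{g})\to C^2_{NLA}(\mathfrak{g},\mathfrak{g})$.
   Context: All vector spaces are over a field $\mathbb{K}$ of characteristic $0$. A (left) Leibniz algebra is a vector space $\mathfrak{g}$ with a bilinear bracket $\mu(x,y)=[x,y]$ satisfying $[x,[y,z]]=[[x,y],z]+[y,[x,z]]$. A Nijenhuis operator is a linear map $N:\mathfrak{g}\to\mathfrak{g}$ with $[Nx,Ny]=N([Nx,y]+[x,Ny]-N[x,y])$; a Nijenhuis Leibniz algebra is a Leibniz algebra with a Nijenhuis operator. A one-parameter formal deformation of $(\mathfrak{g},\mu,N)$ is a pair of power series $\mu_t=\sum_{i\ge0}\mu_it^i$, $N_t=\sum_{i\ge0}N_it^i$ with $\mu_i\in\mathrm{Hom}(\mathfrak{g}^{\otimes2},\mathfrak{g})$, $N_i\in\mathrm{Hom}(\mathfrak{g},\mathfrak{g})$, $(\mu_0,N_0)=(\mu,N)$, such that the $\mathbb{K}[[t]]$-module $\mathfrak{g}[[t]]$ with bracket $\mu_t$ and operator $N_t$ is a Nijenhuis Leibniz algebra over $\mathbb{K}[[t]]$.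 Its infinitesimal is $(\mu_1,N_1)$. Two deformations $(\mu_t,N_t)$, $(\mu'_t,N'_t)$ are equivalent if there is a formal isomorphism, i.e. a power series $\psi_t=\sum_{i\ge0}\psi_it^i:\mathfrak{g}[[t]]\to\mathfrak{g}[[t]]$ with $\psi_i:\mathfrak{g}\to\mathfrak{g}$ linear, $\psi_0=\mathrm{Id}_{\mathfrak{g}}$, $\psi_t\circ\mu'_t=\mu_t\circ(\psi_t\otimes\psi_t)$ and $\psi_t\circ N'_t=N_t\circ\psi_t$. Cochains with coefficients in the adjoint representation $V=\mathfrak{g}$ (actions given by the bracket, $N_V=N$): $C^1_{NLA}(\mathfrak{g},\mathfrak{g})=\mathrm{Hom}(\mathfrak{g},\mathfrak{g})\oplus\mathfrak{g}$, $C^2_{NLA}(\mathfrak{g},\mathfrak{g})=\mathrm{Hom}(\mathfrak{g}^{\otimes2},\mathfrak{g})\oplus\mathrm{Hom}(\mathfrak{g},\mathfrak{g})$, and $d^1(f,g)=(\delta^1f,\,-\partial^0g-\phi^1f)$, where $(\delta^1f)(x,y)=[x,f(y)]+[f(x),y]-f([x,y])$, $(\partial^0g)(x)=-\big([g,Nx]-N[g,x]+[Ng,x]\big)$ and $\phi^1(f)=f\circ N-N\circ f$. The group $H^2_{NLA}(\mathfrak{g},\mathfrak{g})$ is the space of $2$-cocycles modulo the $2$-coboundaries $B^2_{NLA}=\mathrm{im}\,d^1$; two elements are in the same cohomology class when they differ by an element of $B^2_{NLA}$. *)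

theory Defs
  imports "HOL-Computational_Algebra.Formal_Power_Series" "HOL-Library.Product_Plus"
begin

section \<open>Nijenhuis Leibniz algebras over a commutative ring\<close>

text \<open>
  The definitions are made over a commutative ring so that they apply both to the ground field
  (over a field, the locale \<^locale>\<open>module\<close> has the same axioms as \<^locale>\<open>vector_space\<close>) and to the
  algebra of formal power series. Elements of Hom(V \<otimes> V, V) are represented by bilinear maps
  in curried form.
\<close>

definition bilinear_map ::
    "('r::comm_ring_1 \<Rightarrow> 'v::ab_group_add \<Rightarrow> 'v) \<Rightarrow> ('v \<Rightarrow> 'v \<Rightarrow> 'v) \<Rightarrow> bool" where
  "bilinear_map scale b \<longleftrightarrow>
     (\<forall>x. module_hom scale scale (\<lambda>y. b x y)) \<and> (\<forall>y. module_hom scale scale (\<lambda>x. b x y))"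

locale leibniz_algebra = module scale
  for scale :: "'r::comm_ring_1 \<Rightarrow> 'v::ab_group_add \<Rightarrow> 'v" +
  fixes br :: "'v \<Rightarrow> 'v \<Rightarrow> 'v"
  assumes bilinear_br: "bilinear_map scale br"
    and leibniz: "br x (br y z) = br (br x y) z + br y (br x z)"

locale nijenhuis_leibniz_algebra = leibniz_algebra scale br
  for scale :: "'r::comm_ring_1 \<Rightarrow> 'v::ab_group_add \<Rightarrow> 'v" and br :: "'v \<Rightarrow> 'v \<Rightarrow> 'v" +
  fixes N :: "'v \<Rightarrow> 'v"
  assumes linear_N: "module_hom scale scale N"
    and nijenhuis: "br (N x) (N y) = N (br (N x) y + br x (N y) - N (br x y))"

section \<open>Formal deformations\<close>

text \<open>
  The space \<open>V[[t]]\<close> is the type \<open>'v fps\<close>; \<open>fps_scale\<close> is its module structure over \<open>K[[t]]\<close>.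
\<close>

definition fps_scale ::
    "('k::comm_ring_1 \<Rightarrow> 'v::ab_group_add \<Rightarrow> 'v) \<Rightarrow> 'k fps \<Rightarrow> 'v fps \<Rightarrow> 'v fps" where
  "fps_scale scale a x =
     Abs_fps (\<lambda>n. \<Sum>i\<le>n. scale (fps_nth a i) (fps_nth x (n - i)))"

text \<open>
  The maps on \<open>V[[t]]\<close> given by power series \<open>\<Sum>i. f\<^sub>i t\<^sup>i\<close> of linear maps and
  \<open>\<Sum>i. b\<^sub>i t\<^sup>i\<close> of bilinear maps on \<open>V\<close>.
\<close>

definition series_map :: "(nat \<Rightarrow> 'v \<Rightarrow> 'v) \<Rightarrow> 'v fps \<Rightarrow> 'v::ab_group_add fps" where
  "series_map f x = Abs_fps (\<lambda>n. \<Sum>i\<le>n. f i (fps_nth x (n - i)))"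

definition series_bimap ::
    "(nat \<Rightarrow> 'v \<Rightarrow> 'v \<Rightarrow> 'v) \<Rightarrow> 'v fps \<Rightarrow> 'v fps \<Rightarrow> 'v::ab_group_add fps" where
  "series_bimap b x y =
     Abs_fps (\<lambda>n. \<Sum>i\<le>n. \<Sum>j\<le>n - i. b i (fps_nth x j) (fps_nth y (n - i - j)))"

definition formal_deformation ::
    "('k::field_char_0 \<Rightarrow> 'v::ab_group_add \<Rightarrow> 'v) \<Rightarrow> ('v \<Rightarrow> 'v \<Rightarrow> 'v) \<Rightarrow> ('v \<Rightarrow> 'v) \<Rightarrow>
     (nat \<Rightarrow> 'v \<Rightarrow> 'v \<Rightarrow> 'v) \<Rightarrow> (nat \<Rightarrow> 'v \<Rightarrow> 'v) \<Rightarrow> bool" where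
  "formal_deformation scale br N \<mu> \<nu> \<longleftrightarrow>
     (\<forall>i. bilinear_map scale (\<mu> i)) \<and> (\<forall>i. module_hom scale scale (\<nu> i)) \<and>
     \<mu> 0 = br \<and> \<nu> 0 = N \<and>
     nijenhuis_leibniz_algebra (fps_scale scale) (series_bimap \<mu>) (series_map \<nu>)"

definition infinitesimal ::
    "(nat \<Rightarrow> 'v \<Rightarrow> 'v \<Rightarrow> 'v) \<Rightarrow> (nat \<Rightarrow> 'v \<Rightarrow> 'v) \<Rightarrow> ('v \<Rightarrow> 'v \<Rightarrow> 'v) \<times> ('v \<Rightarrow> 'v)" where
  "infinitesimal \<mu> \<nu> = (\<mu> 1, \<nu> 1)"

text \<open>A formal isomorphism goes from the primed deformation to the unprimed one.\<close>

definition formal_isomorphism ::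
    "('k::field_char_0 \<Rightarrow> 'v::ab_group_add \<Rightarrow> 'v) \<Rightarrow>
     (nat \<Rightarrow> 'v \<Rightarrow> 'v \<Rightarrow> 'v) \<Rightarrow> (nat \<Rightarrow> 'v \<Rightarrow> 'v) \<Rightarrow>
     (nat \<Rightarrow> 'v \<Rightarrow> 'v \<Rightarrow> 'v) \<Rightarrow> (nat \<Rightarrow> 'v \<Rightarrow> 'v) \<Rightarrow> (nat \<Rightarrow> 'v \<Rightarrow> 'v) \<Rightarrow> bool" where
  "formal_isomorphism scale \<mu> \<nu> \<mu>' \<nu>' \<psi> \<longleftrightarrow>
     (\<forall>i. module_hom scale scale (\<psi> i)) \<and> \<psi> 0 = id \<and>
     (\<forall>x y. series_map \<psi> (series_bimap \<mu>' x y) =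
            series_bimap \<mu> (series_map \<psi> x) (series_map \<psi> y)) \<and>
     series_map \<psi> \<circ> series_map \<nu>' = series_map \<nu> \<circ> series_map \<psi>"

definition equivalent_deformations ::
    "('k::field_char_0 \<Rightarrow> 'v::ab_group_add \<Rightarrow> 'v) \<Rightarrow>
     (nat \<Rightarrow> 'v \<Rightarrow> 'v \<Rightarrow> 'v) \<Rightarrow> (nat \<Rightarrow> 'v \<Rightarrow> 'v) \<Rightarrow>
     (nat \<Rightarrow> 'v \<Rightarrow> 'v \<Rightarrow> 'v) \<Rightarrow> (nat \<Rightarrow> 'v \<Rightarrow> 'v) \<Rightarrow> bool" where
  "equivalent_deformations scale \<mu> \<nu> \<mu>' \<nu>' \<longleftrightarrow>
     (\<exists>\<psi>. formal_isomorphism scale \<mu> \<nu> \<mu>' \<nu>' \<psi>)"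

section \<open>Low-degree cochains with adjoint coefficients\<close>

definition C1_NLA ::
    "('k::field_char_0 \<Rightarrow> 'v::ab_group_add \<Rightarrow> 'v) \<Rightarrow> (('v \<Rightarrow> 'v) \<times> 'v) set" where
  "C1_NLA scale = {f. module_hom scale scale f} \<times> UNIV"

definition C2_NLA ::
    "('k::field_char_0 \<Rightarrow> 'v::ab_group_add \<Rightarrow> 'v) \<Rightarrow> (('v \<Rightarrow> 'v \<Rightarrow> 'v) \<times> ('v \<Rightarrow> 'v)) set" where
  "C2_NLA scale = {b. bilinear_map scale b} \<times> {f. module_hom scale scale f}"

definition delta1 ::
    "('v::ab_group_add \<Rightarrow> 'v \<Rightarrow> 'v) \<Rightarrow> ('v \<Rightarrow> 'v) \<Rightarrow> 'v \<Rightarrow> 'v \<Rightarrow> 'v" where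
  "delta1 br f = (\<lambda>x y. br x (f y) + br (f x) y - f (br x y))"

definition partial0 ::
    "('v::ab_group_add \<Rightarrow> 'v \<Rightarrow> 'v) \<Rightarrow> ('v \<Rightarrow> 'v) \<Rightarrow> 'v \<Rightarrow> 'v \<Rightarrow> 'v" where
  "partial0 br N g = (\<lambda>x. - (br g (N x) - N (br g x) + br (N g) x))"

definition phi1 :: "('v::ab_group_add \<Rightarrow> 'v) \<Rightarrow> ('v \<Rightarrow> 'v) \<Rightarrow> 'v \<Rightarrow> 'v" where
  "phi1 N f = (f \<circ> N) - (N \<circ> f)"

fun d1_NLA ::
    "('v::ab_group_add \<Rightarrow> 'v \<Rightarrow> 'v) \<Rightarrow> ('v \<Rightarrow> 'v) \<Rightarrow> ('v \<Rightarrow> 'v) \<times> 'v \<Rightarrow>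
     ('v \<Rightarrow> 'v \<Rightarrow> 'v) \<times> ('v \<Rightarrow> 'v)" where
  "d1_NLA br N (f, g) = (delta1 br f, - partial0 br N g - phi1 N f)"

definition B2_NLA ::
    "('k::field_char_0 \<Rightarrow> 'v::ab_group_add \<Rightarrow> 'v) \<Rightarrow> ('v \<Rightarrow> 'v \<Rightarrow> 'v) \<Rightarrow> ('v \<Rightarrow> 'v) \<Rightarrow>
     (('v \<Rightarrow> 'v \<Rightarrow> 'v) \<times> ('v \<Rightarrow> 'v)) set" where
  "B2_NLA scale br N = d1_NLA br N ` C1_NLA scale"

definition same_cohomology_class ::
    "('k::field_char_0 \<Rightarrow> 'v::ab_group_add \<Rightarrow> 'v) \<Rightarrow> ('v \<Rightarrow> 'v \<Rightarrow> 'v) \<Rightarrow> ('v \<Rightarrow> 'v) \<Rightarrow>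
     ('v \<Rightarrow> 'v \<Rightarrow> 'v) \<times> ('v \<Rightarrow> 'v) \<Rightarrow> ('v \<Rightarrow> 'v \<Rightarrow> 'v) \<times> ('v \<Rightarrow> 'v) \<Rightarrow> bool" where
  "same_cohomology_class scale br N c c' \<longleftrightarrow>
     c \<in> C2_NLA scale \<and> c' \<in> C2_NLA scale \<and> c' - c \<in> B2_NLA scale br N"

end

theory Submission
  imports Defs
begin

text \<open>
  Write \<open>\<psi>\<close> for a formal isomorphism with \<open>\<psi> 0 = id\<close>. Its two intertwining equations are identities
  in \<open>V[[t]]\<close>; evaluated at constant series, their coefficients of \<open>t\<close> read
  \<open>\<mu>' 1 x y + \<psi> 1 [x, y] = \<mu> 1 x y + [x, \<psi> 1 y] + [\<psi> 1 x, y]\<close> and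
  \<open>\<nu>' 1 x + \<psi> 1 (N x) = \<nu> 1 x + N (\<psi> 1 x)\<close>.
  The first says that the brackets of the infinitesimals differ by \<open>delta1 br (\<psi> 1)\<close>
  (lemma \<open>first_order_bracket\<close>), the second that their operators differ by \<open>- phi1 N (\<psi> 1)\<close>
  (lemma \<open>first_order_operator\<close>). As the contribution of the vector \<open>0\<close> through \<open>partial0\<close>
  vanishes, the difference of the infinitesimals is the coboundary of the 1-cochain \<open>(\<psi> 1, 0)\<close>.
\<close>

lemma series_map_nth_0: "fps_nth (series_map f x) 0 = f 0 (fps_nth x 0)"
  by (simp add: series_map_def)

lemma series_map_nth_1:
  "fps_nth (series_map f x) 1 = f 0 (fps_nth x 1) + f 1 (fps_nth x 0)"
  by (simp add: series_map_def)

lemma series_bimap_nth_0: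
  "fps_nth (series_bimap b x y) 0 = b 0 (fps_nth x 0) (fps_nth y 0)"
  by (simp add: series_bimap_def)

lemma series_bimap_nth_1:
  "fps_nth (series_bimap b x y) 1 =
     b 0 (fps_nth x 0) (fps_nth y 1) + b 0 (fps_nth x 1) (fps_nth y 0)
       + b 1 (fps_nth x 0) (fps_nth y 0)"
  by (simp add: series_bimap_def)

lemma bilinear_map_zero_left: "bilinear_map scale b \<Longrightarrow> b 0 y = 0"
  unfolding bilinear_map_def by (metis module_hom.zero)

lemma bilinear_map_zero_right: "bilinear_map scale b \<Longrightarrow> b x 0 = 0"
  unfolding bilinear_map_def by (metis module_hom.zero)

text \<open>
  In each coefficient of \<open>t\<close> exactly one factor has degree 1. Constant series contribute none, so
  that factor is \<open>\<psi> 1\<close>, \<open>\<mu> 1\<close> or \<open>\<mu>' 1\<close>, and all others are \<open>id\<close> or the undeformed bracket.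
\<close>

lemma first_order_bracket:
  assumes iso: "formal_isomorphism scale \<mu> \<nu> \<mu>' \<nu>' \<psi>"
    and bil: "bilinear_map scale br" and start: "\<mu> 0 = br" "\<mu>' 0 = br"
  shows "\<mu>' 1 - \<mu> 1 = delta1 br (\<psi> 1)"
proof (intro ext)
  fix x y
  have psi0: "\<psi> 0 = id"
    and intertwines: "series_map \<psi> (series_bimap \<mu>' (fps_const x) (fps_const y)) =
      series_bimap \<mu> (series_map \<psi> (fps_const x)) (series_map \<psi> (fps_const y))"
    using iso by (auto simp: formal_isomorphism_def)
  from arg_cong[OF intertwines, of "\<lambda>z. fps_nth z 1"]
  have "\<mu>' 1 x y + \<psi> 1 (br x y) = br x (\<psi> 1 y) + br (\<psi> 1 x) y + \<mu> 1 x y"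
    unfolding series_map_nth_0 series_map_nth_1 series_bimap_nth_0 series_bimap_nth_1
    by (simp add: psi0 start bilinear_map_zero_left[OF bil] bilinear_map_zero_right[OF bil])
  then show "(\<mu>' 1 - \<mu> 1) x y = delta1 br (\<psi> 1) x y"
    by (simp add: delta1_def algebra_simps)
qed

text \<open>
  The sign is opposite to that in the bracket equation: \<open>\<psi> 1 \<circ> N\<close> stands on the primed side, and
  \<open>phi1\<close> counts \<open>f \<circ> N\<close> positively. It matches the sign of \<open>phi1\<close> in \<open>d1_NLA\<close>.
\<close>

lemma first_order_operator:
  assumes iso: "formal_isomorphism scale \<mu> \<nu> \<mu>' \<nu>' \<psi>"
    and lin: "module_hom scale scale N" and start: "\<nu> 0 = N" "\<nu>' 0 = N"
  shows "\<nu>' 1 - \<nu> 1 = - phi1 N (\<psi> 1)"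
proof
  fix x
  have psi0: "\<psi> 0 = id"
    and intertwines: "series_map \<psi> \<circ> series_map \<nu>' = series_map \<nu> \<circ> series_map \<psi>"
    using iso by (auto simp: formal_isomorphism_def)
  from arg_cong[OF fun_cong[OF intertwines, of "fps_const x"], of "\<lambda>z. fps_nth z 1"]
  have "\<nu>' 1 x + \<psi> 1 (N x) = N (\<psi> 1 x) + \<nu> 1 x"
    unfolding o_apply series_map_nth_0 series_map_nth_1
    by (simp add: psi0 start module_hom.zero[OF lin])
  then show "(\<nu>' 1 - \<nu> 1) x = (- phi1 N (\<psi> 1)) x"
    by (simp add: phi1_def algebra_simps)
qed

lemma d1_NLA_zero_vector:
  assumes "bilinear_map scale br" and "module_hom scale scale N"
  shows "d1_NLA br N (f, 0) = (delta1 br f, - phi1 N f)"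
  by (simp add: fun_eq_iff partial0_def bilinear_map_zero_left[OF assms(1)]
      module_hom.zero[OF assms(2)])

theorem theorem5p4:
  fixes scale :: "'k::field_char_0 \<Rightarrow> 'v::ab_group_add \<Rightarrow> 'v"
    and br :: "'v \<Rightarrow> 'v \<Rightarrow> 'v" and N :: "'v \<Rightarrow> 'v"
    and \<mu> \<mu>' :: "nat \<Rightarrow> 'v \<Rightarrow> 'v \<Rightarrow> 'v" and \<nu> \<nu>' :: "nat \<Rightarrow> 'v \<Rightarrow> 'v"
  assumes "nijenhuis_leibniz_algebra scale br N"
    and "formal_deformation scale br N \<mu> \<nu>"
    and "formal_deformation scale br N \<mu>' \<nu>'"
    and "equivalent_deformations scale \<mu> \<nu> \<mu>' \<nu>'"
  shows "same_cohomology_class scale br N (infinitesimal \<mu> \<nu>) (infinitesimal \<mu>' \<nu>')"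
proof -
  interpret nijenhuis_leibniz_algebra scale br N by fact
  have start: "\<mu> 0 = br" "\<mu>' 0 = br" "\<nu> 0 = N" "\<nu>' 0 = N"
    and cochains: "infinitesimal \<mu> \<nu> \<in> C2_NLA scale" "infinitesimal \<mu>' \<nu>' \<in> C2_NLA scale"
    using assms(2,3) by (auto simp: formal_deformation_def infinitesimal_def C2_NLA_def)
  obtain \<psi> where iso: "formal_isomorphism scale \<mu> \<nu> \<mu>' \<nu>' \<psi>"
    using assms(4) by (auto simp: equivalent_deformations_def)
  have "infinitesimal \<mu>' \<nu>' - infinitesimal \<mu> \<nu> = d1_NLA br N (\<psi> 1, 0)"
    using first_order_bracket[OF iso bilinear_br start(1,2)]
      first_order_operator[OF iso linear_N start(3,4)]
    by (simp add: infinitesimal_def d1_NLA_zero_vector[OF bilinear_br linear_N]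
        del: d1_NLA.simps)
  moreover have "(\<psi> 1, 0) \<in> C1_NLA scale"
    using iso by (simp add: formal_isomorphism_def C1_NLA_def)
  ultimately show ?thesis
    using cochains unfolding same_cohomology_class_def B2_NLA_def by blast
qed

end
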